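(* Let $X$ be a pseudocompact space. If $X$ is quasi $\kappa$-metrizable, then its Čech–Stone compactification $\beta X$ is quasi $\kappa$-metrizable. If $X$ is regularly quasi $\kappa$-metrizable, then $\beta X$ is regularly quasi $\kappa$-metrizable.
   Context: All topological spaces are assumed Tychonoff. A set $C\subset X$ is regularly closed if it is the closure of an open set. A quasi $\kappa$-metric on a space $X$ is a non-negative real-valued function $\rho(x,C)$ of a point $x\in X$ and a regularly closed set $C\subset X$ such that: K1)$^*$ for any regularly closed $C$ there is a dense open subset $V$ of $X\setminus C$ such that $\rho(x,C)>0$ iff $x\in V$; K2) if $C\subset C'$, then $\rho(x,C')\le\rho(x,C)$ for every $x\in X$; K3) for every $C$, $\rho(x,C)$ is a continuous function of $x$; K4) $\rho(x,\overline{\bigcup_\alpha C_\alpha})=\inf_\alpha\rho(x,C_\alpha)$ for every $x\in X$ and every increasing transfinite (i.e. well-ordered by index) family $\{C_\alpha\}$ of regularly closed sets in $X$. It is regular if moreover: K5) $\rho(x,C)\le\rho(x,C')+\overline\rho(C',C)$ for any $x\in X$ and any regularly closed $C,C'$, where $\overline\rho(C',C)=\sup\{\rho(y,C):y\in C'\}$. A space is (regularly) quasi $\kappa$-metrizable if it admits a (regular) quasi $\kappa$-metric. *)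

theory Defs
  imports "HOL-Analysis.Analysis"
begin

section \<open>Spaces\<close>

definition Tychonoff_space :: "'a topology \<Rightarrow> bool" where
  "Tychonoff_space X \<longleftrightarrow> completely_regular_space X \<and> Hausdorff_space X"

definition pseudocompact_space :: "'a topology \<Rightarrow> bool" where
  "pseudocompact_space X \<longleftrightarrow>
     (\<forall>f. continuous_map X euclideanreal f \<longrightarrow> bounded (f ` topspace X))"

definition regularly_closedin :: "'a topology \<Rightarrow> 'a set \<Rightarrow> bool" where
  "regularly_closedin X C \<longleftrightarrow> (\<exists>U. openin X U \<and> C = X closure_of U)"

section \<open>Quasi kappa-metrics\<close>

text \<open>
  Only the values \<open>\<rho> x C\<close> with \<open>x \<in> topspace X\<close> and \<open>C\<close> regularly closed are constrained.

  In (K4) a transfinite family is a family indexed by the field of a nonempty well-order.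
  The indices are taken from the type \<open>'a set\<close>, since HOL cannot quantify over index types inside
  a definition. This loses no generality: an increasing well-ordered family can be reindexed by its
  own range; see \<open>quasi_kappa_metric_on_increasing\<close> below.
\<close>

definition quasi_kappa_metric_on :: "'a topology \<Rightarrow> ('a \<Rightarrow> 'a set \<Rightarrow> real) \<Rightarrow> bool" where
  "quasi_kappa_metric_on X \<rho> \<longleftrightarrow>
     (\<forall>x\<in>topspace X. \<forall>C. regularly_closedin X C \<longrightarrow> 0 \<le> \<rho> x C) \<and>
     \<comment> \<open>(K1)*\<close>
     (\<forall>C. regularly_closedin X C \<longrightarrow>
        (\<exists>V. openin (subtopology X (topspace X - C)) V \<and>
             subtopology X (topspace X - C) closure_of V = topspace X - C \<and>
             (\<forall>x\<in>topspace X. \<rho> x C > 0 \<longleftrightarrow> x \<in> V))) \<and>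
     \<comment> \<open>(K2)\<close>
     (\<forall>C C'. regularly_closedin X C \<and> regularly_closedin X C' \<and> C \<subseteq> C' \<longrightarrow>
        (\<forall>x\<in>topspace X. \<rho> x C' \<le> \<rho> x C)) \<and>
     \<comment> \<open>(K3)\<close>
     (\<forall>C. regularly_closedin X C \<longrightarrow> continuous_map X euclideanreal (\<lambda>x. \<rho> x C)) \<and>
     \<comment> \<open>(K4)\<close>
     (\<forall>(r :: 'a set rel) (C :: 'a set \<Rightarrow> 'a set).
        Well_order r \<and> Field r \<noteq> {} \<and>
        (\<forall>\<alpha>\<in>Field r. regularly_closedin X (C \<alpha>)) \<and>
        (\<forall>\<alpha> \<beta>. (\<alpha>, \<beta>) \<in> r \<longrightarrow> C \<alpha> \<subseteq> C \<beta>) \<longrightarrow>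
        (\<forall>x\<in>topspace X.
           \<rho> x (X closure_of (\<Union>\<alpha>\<in>Field r. C \<alpha>)) = (INF \<alpha>\<in>Field r. \<rho> x (C \<alpha>))))"

text \<open>
  The supremum in (K5) may be infinite on a general space and is \<open>0\<close> on the empty set,
  so it is taken in the extended nonnegative reals.
\<close>

definition regular_quasi_kappa_metric_on :: "'a topology \<Rightarrow> ('a \<Rightarrow> 'a set \<Rightarrow> real) \<Rightarrow> bool" where
  "regular_quasi_kappa_metric_on X \<rho> \<longleftrightarrow>
     quasi_kappa_metric_on X \<rho> \<and>
     \<comment> \<open>(K5)\<close>
     (\<forall>x\<in>topspace X. \<forall>C C'. regularly_closedin X C \<and> regularly_closedin X C' \<longrightarrow>
        ennreal (\<rho> x C) \<le> ennreal (\<rho> x C') + (SUP y\<in>C'. ennreal (\<rho> y C)))"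

definition quasi_kappa_metrizable :: "'a topology \<Rightarrow> bool" where
  "quasi_kappa_metrizable X \<longleftrightarrow> (\<exists>\<rho>. quasi_kappa_metric_on X \<rho>)"

definition regularly_quasi_kappa_metrizable :: "'a topology \<Rightarrow> bool" where
  "regularly_quasi_kappa_metrizable X \<longleftrightarrow> (\<exists>\<rho>. regular_quasi_kappa_metric_on X \<rho>)"

lemma quasi_kappa_metric_on_increasing:
  fixes r :: "'i rel" and C :: "'i \<Rightarrow> 'a set"
  assumes \<rho>: "quasi_kappa_metric_on X \<rho>" and r: "Well_order r" "Field r \<noteq> {}"
    and C: "\<And>\<alpha>. \<alpha> \<in> Field r \<Longrightarrow> regularly_closedin X (C \<alpha>)"
    and mono: "\<And>\<alpha> \<beta>. (\<alpha>, \<beta>) \<in> r \<Longrightarrow> C \<alpha> \<subseteq> C \<beta>"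
    and x: "x \<in> topspace X"
  shows "\<rho> x (X closure_of (\<Union>\<alpha>\<in>Field r. C \<alpha>)) = (INF \<alpha>\<in>Field r. \<rho> x (C \<alpha>))"
proof -
  have K4: "Well_order r' \<and> Field r' \<noteq> {} \<and>
        (\<forall>\<alpha>\<in>Field r'. regularly_closedin X (C' \<alpha>)) \<and>
        (\<forall>\<alpha> \<beta>. (\<alpha>, \<beta>) \<in> r' \<longrightarrow> C' \<alpha> \<subseteq> C' \<beta>) \<longrightarrow>
        (\<forall>x\<in>topspace X.
           \<rho> x (X closure_of (\<Union>\<alpha>\<in>Field r'. C' \<alpha>)) = (INF \<alpha>\<in>Field r'. \<rho> x (C' \<alpha>)))"
    for r' :: "'a set rel" and C' :: "'a set \<Rightarrow> 'a set"
    using \<rho> unfolding quasi_kappa_metric_on_def by (elim conjE) (erule allE)+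
  define R where "R = C ` Field r"
  define s where "s = {(A, B). A \<in> R \<and> B \<in> R \<and> A \<subseteq> B}"
  have tot: "A \<subseteq> B \<or> B \<subseteq> A" if AB: "A \<in> R" "B \<in> R" for A B
  proof -
    obtain a b where ab: "a \<in> Field r" "b \<in> Field r" "A = C a" "B = C b"
      using AB by (auto simp: R_def)
    moreover have "a = b \<or> (a, b) \<in> r \<or> (b, a) \<in> r"
      using r(1) ab(1,2) by (auto simp: order_on_defs total_on_def)
    ultimately show ?thesis
      using mono by blast
  qed
  have Fs: "Field s = R"
    by (auto simp: s_def Field_def)
  have wf: "wf (s - Id)"
  proof (rule wfI_min)
    fix A :: "'a set" and Q
    assume A: "A \<in> Q"
    show "\<exists>Z\<in>Q. \<forall>Y. (Y, Z) \<in> s - Id \<longrightarrow> Y \<notin> Q"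
    proof (cases "A \<in> R")
      case False
      then show ?thesis using A by (auto simp: s_def)
    next
      case True
      then obtain a where a: "a \<in> {a \<in> Field r. C a \<in> Q}"
        using A by (auto simp: R_def)
      have "wf (r - Id)"
        using r(1) by (simp add: well_order_on_def)
      then obtain m where m: "m \<in> Field r" "C m \<in> Q"
        "\<And>y. (y, m) \<in> r - Id \<Longrightarrow> \<not> (y \<in> Field r \<and> C y \<in> Q)"
        using wfE_min[OF _ a] by (metis (no_types, lifting) mem_Collect_eq)
      have "Y \<notin> Q" if Y: "(Y, C m) \<in> s - Id" for Y
      proof
        assume "Y \<in> Q"
        obtain y where y: "y \<in> Field r" "Y = C y"
          using Y by (auto simp: s_def R_def)
        have "y \<noteq> m" using Y y by auto
        then have "(y, m) \<in> r \<or> (m, y) \<in> r"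
          using r(1) y(1) m(1) by (auto simp: order_on_defs total_on_def)
        moreover have "(y, m) \<notin> r"
          using m(3)[of y] \<open>y \<noteq> m\<close> y \<open>Y \<in> Q\<close> by auto
        ultimately have "C m \<subseteq> C y" using mono by blast
        then show False using Y y by (auto simp: s_def)
      qed
      then show ?thesis using m(2) by blast
    qed
  qed
  have "Well_order s"
    unfolding well_order_on_def linear_order_on_def partial_order_on_def preorder_on_def Fs
    using tot wf
    by (auto simp: s_def refl_on_def trans_def antisym_def total_on_def)
  moreover have "Field s \<noteq> {}"
    using r(2) by (simp add: Fs R_def)
  moreover have "regularly_closedin X (id A)" if "A \<in> Field s" for A
    using that C by (auto simp: Fs R_def)
  moreover have "id A \<subseteq> id B" if "(A, B) \<in> s" for A B
    using that by (simp add: s_def)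
  ultimately have "\<rho> x (X closure_of (\<Union>A\<in>Field s. id A)) = (INF A\<in>Field s. \<rho> x (id A))"
    using K4[of s id] x by blast
  then show ?thesis
    by (simp add: Fs R_def image_image)
qed

section \<open>The Cech-Stone compactification\<close>

text \<open>
  The closure of the image of \<open>X\<close> in the cube \<open>[0,1]\<^sup>C\<close>, where \<open>C\<close> is the set of continuous functions
  from \<open>X\<close> to \<open>[0,1]\<close>. The functions are made extensional so that each of them occurs
  only once as a coordinate.
\<close>

definition unit_functions :: "'a topology \<Rightarrow> ('a \<Rightarrow> real) set" where
  "unit_functions X = {f \<in> extensional (topspace X). continuous_map X (top_of_set {0..1}) f}"

definition unit_cube :: "'a topology \<Rightarrow> (('a \<Rightarrow> real) \<Rightarrow> real) topology" where
  "unit_cube X = product_topology (\<lambda>f. top_of_set {0..1}) (unit_functions X)"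

definition Cech_Stone_map :: "'a topology \<Rightarrow> 'a \<Rightarrow> ('a \<Rightarrow> real) \<Rightarrow> real" where
  "Cech_Stone_map X x = (\<lambda>f\<in>unit_functions X. f x)"

definition Cech_Stone :: "'a topology \<Rightarrow> (('a \<Rightarrow> real) \<Rightarrow> real) topology" where
  "Cech_Stone X =
     subtopology (unit_cube X) (unit_cube X closure_of (Cech_Stone_map X ` topspace X))"

lemma compact_space_Cech_Stone: "compact_space (Cech_Stone X)"
proof -
  have "compact_space (unit_cube X)"
    by (simp add: unit_cube_def compact_space_product_topology compact_space_subtopology)
  then show ?thesis
    by (simp add: Cech_Stone_def closedin_compact_space compact_space_subtopology)
qed

lemma Hausdorff_space_Cech_Stone: "Hausdorff_space (Cech_Stone X)"
  unfolding Cech_Stone_def unit_cube_def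
  by (intro Hausdorff_space_subtopology)
     (simp add: Hausdorff_space_product_topology Hausdorff_space_subtopology)

lemma Cech_Stone_map_in_cube: "Cech_Stone_map X ` topspace X \<subseteq> topspace (unit_cube X)"
proof -
  have "f x \<in> {0..1}" if "f \<in> unit_functions X" "x \<in> topspace X" for f x
    using that continuous_map_image_subset_topspace[of X "top_of_set {0..1}" f]
    by (auto simp: unit_functions_def simp del: continuous_map_in_subtopology)
  then show ?thesis
    by (auto simp: Cech_Stone_map_def unit_cube_def)
qed

lemma dense_Cech_Stone_map:
  "Cech_Stone X closure_of (Cech_Stone_map X ` topspace X) = topspace (Cech_Stone X)"
proof -
  have "Cech_Stone_map X ` topspace X \<subseteq> unit_cube X closure_of (Cech_Stone_map X ` topspace X)"
    by (simp add: Cech_Stone_map_in_cube closure_of_subset)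
  then show ?thesis
    by (simp add: Cech_Stone_def closure_of_subtopology closure_of_subset_topspace inf.absorb2)
qed

lemma embedding_map_Cech_Stone_map:
  assumes "Tychonoff_space X"
  shows "embedding_map X (Cech_Stone X) (Cech_Stone_map X)"
proof -
  have eq: "mspace (submetric (cfunspace X euclidean_metric) {f. f \<in> topspace X \<rightarrow> {0..1}})
            = unit_functions X"
  proof -
    have "bounded (f ` topspace X)" if "f \<in> topspace X \<rightarrow> {0..1::real}" for f
      using that bounded_subset[OF bounded_closed_interval[of "0::real" 1]] by blast
    then show ?thesis
      by (auto simp: unit_functions_def continuous_map_in_subtopology)
  qed
  have "embedding_map X (unit_cube X) (Cech_Stone_map X)"
    using completely_regular_space_cube_embedding_explicit[of X] assms
    unfolding eq Tychonoff_space_def unit_cube_def Cech_Stone_map_def[abs_def] by simp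
  then show ?thesis
    unfolding Cech_Stone_def embedding_map_in_subtopology
    by (simp add: Cech_Stone_map_in_cube closure_of_subset)
qed

lemma Cech_Stone_extension:
  assumes f: "continuous_map X (top_of_set {0..1::real}) f"
  obtains g where "continuous_map (Cech_Stone X) (top_of_set {0..1}) g"
    and "\<And>x. x \<in> topspace X \<Longrightarrow> g (Cech_Stone_map X x) = f x"
proof
  have f': "restrict f (topspace X) \<in> unit_functions X"
    using f continuous_map_eq[of X "top_of_set {0..1}" f "restrict f (topspace X)"]
    by (simp add: unit_functions_def)
  show "continuous_map (Cech_Stone X) (top_of_set {0..1}) (\<lambda>p. p (restrict f (topspace X)))"
    unfolding Cech_Stone_def unit_cube_def
    by (intro continuous_map_from_subtopology continuous_map_product_projection f')
  show "\<And>x. x \<in> topspace X \<Longrightarrow> Cech_Stone_map X x (restrict f (topspace X)) = f x"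
    using f' by (simp add: Cech_Stone_map_def)
qed

end

(*
  Traces identify the regularly closed sets of beta X with those of X, and rho(., C) is bounded
  because X is pseudocompact, so it extends continuously to beta X. Everything except (K4) passes
  to these extensions by density. For (K4) the infimum has to be uniform on X. If it were not,
  a sequence of indices could be chosen greedily along which, at suitable points x_n, the n-th
  function exceeds the next one by a fixed amount. By (K4) the functions along this sequence
  decrease to a continuous function, so this contradicts Dini's theorem, which holds on
  pseudocompact spaces for sequences (although not for transfinite families).
*)
theory Submission
  imports Defs
begin

section \<open>Dini's theorem for sequences on pseudocompact spaces\<close>

lemma continuous_map_suminf_locally_finite:
  fixes f :: "nat \<Rightarrow> 'a \<Rightarrow> real"
  assumes cont: "\<And>n. continuous_map X euclideanreal (f n)"
    and fin: "\<And>x. x \<in> topspace X \<Longrightarrow> \<exists>U m. openin X U \<and> x \<in> U \<and> (\<forall>y\<in>U. \<forall>n\<ge>m. f n y = 0)"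
  shows "continuous_map X euclideanreal (\<lambda>x. \<Sum>n. f n x)"
proof -
  have "\<exists>U. openin X U \<and> x \<in> U \<and> continuous_map (subtopology X U) euclideanreal (\<lambda>x. \<Sum>n. f n x)"
    if x: "x \<in> topspace X" for x
  proof -
    obtain U m where U: "openin X U" "x \<in> U" and m: "\<And>y n. y \<in> U \<Longrightarrow> n \<ge> m \<Longrightarrow> f n y = 0"
      using fin[OF x] by blast
    have "continuous_map (subtopology X U) euclideanreal (\<lambda>x. \<Sum>n<m. f n x)"
      by (intro continuous_map_sum continuous_map_from_subtopology cont) auto
    moreover have "(\<Sum>n. f n y) = (\<Sum>n<m. f n y)" if "y \<in> U" for y
      by (rule suminf_finite) (use m[OF that] in auto)
    ultimately have "continuous_map (subtopology X U) euclideanreal (\<lambda>x. \<Sum>n. f n x)"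
      by (elim continuous_map_eq) auto
    then show ?thesis using U by blast
  qed
  then obtain U where U: "\<And>x. x \<in> topspace X \<Longrightarrow> openin X (U x) \<and> x \<in> U x \<and>
      continuous_map (subtopology X (U x)) euclideanreal (\<lambda>x. \<Sum>n. f n x)"
    by metis
  show ?thesis
    by (rule pasting_lemma[of "topspace X" X U euclideanreal "\<lambda>_ x. \<Sum>n. f n x"])
       (use U in auto)
qed

text \<open>If every \<open>h n\<close> reached \<epsilon> at some point \<open>x n\<close>, then
  summing the parts of all \<open>h n\<close> above \<epsilon>/2 would give a locally finite series,
  hence a continuous and so bounded function; but at \<open>x n\<close> its first \<open>n\<close>
  terms are all at least \<epsilon>/2.\<close>

lemma pseudocompact_Dini:
  fixes h :: "nat \<Rightarrow> 'a \<Rightarrow> real"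
  assumes X: "pseudocompact_space X"
    and cont: "\<And>n. continuous_map X euclideanreal (h n)"
    and dec: "\<And>x. x \<in> topspace X \<Longrightarrow> decseq (\<lambda>n. h n x)"
    and lim: "\<And>x. x \<in> topspace X \<Longrightarrow> (\<lambda>n. h n x) \<longlonglongrightarrow> 0"
    and \<epsilon>: "0 < \<epsilon>"
  obtains n where "\<And>x. x \<in> topspace X \<Longrightarrow> h n x < \<epsilon>"
proof (rule ccontr)
  assume "\<not> thesis"
  then have "\<forall>n. \<exists>x. x \<in> topspace X \<and> \<epsilon> \<le> h n x"
    using that by (meson not_le)
  then obtain x where x: "\<And>n. x n \<in> topspace X" "\<And>n. \<epsilon> \<le> h n (x n)"
    by metis
  \<comment> \<open>Cutting at \<epsilon>/2 leaves room on both sides: convergence to 0 makes the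
    terms eventually vanish near each point, while a value of at least \<epsilon> still contributes
    \<epsilon>/2.\<close>
  define f where "f n y = max 0 (h n y - \<epsilon> / 2)" for n y
  define H where "H y = (\<Sum>n. f n y)" for y
  have loc: "\<exists>U m. openin X U \<and> y \<in> U \<and> (\<forall>z\<in>U. \<forall>n\<ge>m. f n z = 0)" if y: "y \<in> topspace X" for y
  proof -
    obtain m where m: "h m y < \<epsilon> / 2"
      using order_tendstoD(2)[OF lim[OF y], of "\<epsilon> / 2"] \<epsilon>
      by (auto simp: eventually_sequentially)
    \<comment> \<open>Where \<open>h m\<close> is below \<epsilon>/2, so are all later functions,
      because the sequence decreases.\<close>
    let ?U = "{z \<in> topspace X. h m z \<in> {..<\<epsilon> / 2}}"
    have "openin X ?U"
      by (rule openin_continuous_map_preimage[OF cont]) auto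
    moreover have "f n z = 0" if "z \<in> ?U" "n \<ge> m" for n z
      using that dec[of z] by (fastforce simp: f_def decseq_def max_def)
    ultimately show ?thesis using y m by blast
  qed
  have "continuous_map X euclideanreal H"
    unfolding H_def
  proof (rule continuous_map_suminf_locally_finite)
    show "continuous_map X euclideanreal (f n)" for n
      unfolding f_def by (intro continuous_map_real_max continuous_map_diff cont) auto
  qed (rule loc)
  then obtain B where B: "\<And>y. y \<in> topspace X \<Longrightarrow> \<bar>H y\<bar> \<le> B"
    using X unfolding pseudocompact_space_def bounded_iff by fastforce
  have low: "real n * (\<epsilon> / 2) \<le> B" for n
  proof -
    \<comment> \<open>\<open>suminf\<close> has no meaningful value on a divergent series, so
      summability has to be known before partial sums can be compared with
      \<open>H (x n)\<close>.\<close>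
    have summ: "summable (\<lambda>k. f k (x n))"
    proof -
      obtain m where "\<And>k. k \<ge> m \<Longrightarrow> f k (x n) = 0"
        using loc[OF x(1)] by blast
      then show ?thesis
        by (intro summable_finite[of "{..<m}"]) auto
    qed
    have "\<epsilon> / 2 \<le> f k (x n)" if "k < n" for k
      using decseqD[OF dec[OF x(1)], of k n n] x(2)[of n] that by (simp add: f_def max_def)
    then have "real n * (\<epsilon> / 2) \<le> (\<Sum>k<n. f k (x n))"
      using sum_bounded_below[of "{..<n}" "\<epsilon> / 2" "\<lambda>k. f k (x n)"] by simp
    also have "\<dots> \<le> H (x n)"
      unfolding H_def by (rule sum_le_suminf[OF summ]) (auto simp: f_def)
    also have "\<dots> \<le> B" using B[OF x(1)[of n]] by simp
    finally show ?thesis .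
  qed
  obtain n :: nat where "B / (\<epsilon> / 2) < real n"
    using reals_Archimedean2 by blast
  then show False
    using low[of n] \<epsilon> by (simp add: field_simps)
qed

section \<open>Elementary properties of quasi kappa-metrics and regularly closed sets\<close>

context
  fixes X :: "'a topology" and \<rho> :: "'a \<Rightarrow> 'a set \<Rightarrow> real"
  assumes \<rho>: "quasi_kappa_metric_on X \<rho>"
begin

lemma quasi_kappa_metric_nonneg:
  "x \<in> topspace X \<Longrightarrow> regularly_closedin X C \<Longrightarrow> 0 \<le> \<rho> x C"
  using \<rho> unfolding quasi_kappa_metric_on_def by (elim conjE) blast

lemma quasi_kappa_metric_positive_set:
  assumes "regularly_closedin X C"
  obtains V where "openin (subtopology X (topspace X - C)) V"
    "subtopology X (topspace X - C) closure_of V = topspace X - C"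
    "\<And>x. x \<in> topspace X \<Longrightarrow> \<rho> x C > 0 \<longleftrightarrow> x \<in> V"
proof -
  have "\<forall>C. regularly_closedin X C \<longrightarrow>
        (\<exists>V. openin (subtopology X (topspace X - C)) V \<and>
             subtopology X (topspace X - C) closure_of V = topspace X - C \<and>
             (\<forall>x\<in>topspace X. \<rho> x C > 0 \<longleftrightarrow> x \<in> V))"
    using \<rho> unfolding quasi_kappa_metric_on_def by (elim conjE)
  then show ?thesis using assms that by metis
qed

lemma quasi_kappa_metric_antimono:
  "regularly_closedin X C \<Longrightarrow> regularly_closedin X C' \<Longrightarrow> C \<subseteq> C' \<Longrightarrow> x \<in> topspace X
    \<Longrightarrow> \<rho> x C' \<le> \<rho> x C"
  using \<rho> unfolding quasi_kappa_metric_on_def by (elim conjE) blast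

lemma quasi_kappa_metric_continuous:
  "regularly_closedin X C \<Longrightarrow> continuous_map X euclideanreal (\<lambda>x. \<rho> x C)"
  using \<rho> unfolding quasi_kappa_metric_on_def by (elim conjE) blast

lemma quasi_kappa_metric_eq_0:
  assumes C: "regularly_closedin X C" and x: "x \<in> topspace X" "x \<in> C"
  shows "\<rho> x C = 0"
proof -
  obtain V where V: "openin (subtopology X (topspace X - C)) V"
    "\<rho> x C > 0 \<longleftrightarrow> x \<in> V"
    using quasi_kappa_metric_positive_set[OF C] x(1) by metis
  then have "\<not> \<rho> x C > 0"
    using openin_subset[OF V(1)] x by auto
  then show ?thesis
    using quasi_kappa_metric_nonneg[OF x(1) C] by simp
qed

end

text \<open>Each \<open>C i\<close> is the closure of an open \<open>U i\<close>, and the union of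
  the \<open>U i\<close> is dense in the union of the \<open>C i\<close>. That the open set lies
  inside the union is recorded because traces of such closures are computed with it.\<close>

lemma regularly_closedin_closure_Union:
  assumes "\<And>i. i \<in> I \<Longrightarrow> regularly_closedin X (C i)"
  shows "\<exists>U. openin X U \<and> U \<subseteq> (\<Union>i\<in>I. C i) \<and> X closure_of (\<Union>i\<in>I. C i) = X closure_of U"
proof -
  obtain U where U: "\<And>i. i \<in> I \<Longrightarrow> openin X (U i) \<and> C i = X closure_of (U i)"
    using assms unfolding regularly_closedin_def by metis
  have sub: "(\<Union>i\<in>I. U i) \<subseteq> (\<Union>i\<in>I. C i)"
    using U by (intro UN_mono) (auto intro: closure_of_subset[OF openin_subset, THEN subsetD])
  have "C i \<subseteq> X closure_of (\<Union>i\<in>I. U i)" if "i \<in> I" for i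
    using U[OF that] that by (metis UN_upper closure_of_mono)
  then have "X closure_of (\<Union>i\<in>I. C i) \<subseteq> X closure_of (\<Union>i\<in>I. U i)"
    by (intro closure_of_minimal) auto
  then have "X closure_of (\<Union>i\<in>I. C i) = X closure_of (\<Union>i\<in>I. U i)"
    using closure_of_mono[OF sub] by (rule subset_antisym)
  moreover have "openin X (\<Union>i\<in>I. U i)"
    using U by blast
  ultimately show ?thesis using sub by blast
qed

lemma regularly_closedin_closure_of_Union:
  "(\<And>i. i \<in> I \<Longrightarrow> regularly_closedin X (C i)) \<Longrightarrow> regularly_closedin X (X closure_of (\<Union>i\<in>I. C i))"
  using regularly_closedin_closure_Union[of I X C] unfolding regularly_closedin_def by blast

section \<open>From pointwise to uniform infima in (K4)\<close>

lemma quasi_kappa_metric_LIMSEQ: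
  fixes C :: "nat \<Rightarrow> 'a set"
  assumes \<rho>: "quasi_kappa_metric_on X \<rho>"
    and C: "\<And>n. regularly_closedin X (C n)" and mono: "mono C" and x: "x \<in> topspace X"
  shows "(\<lambda>n. \<rho> x (C n)) \<longlonglongrightarrow> \<rho> x (X closure_of (\<Union>n. C n))"
proof -
  \<comment> \<open>This is (K4) for the well-order \<open>natLeq\<close>; for a decreasing sequence
    bounded below, the infimum is the limit.\<close>
  have eq: "\<rho> x (X closure_of (\<Union>n. C n)) = (INF n. \<rho> x (C n))"
    using quasi_kappa_metric_on_increasing[OF \<rho> natLeq_Well_order, of C x] C x mono
    unfolding Field_natLeq by (simp add: natLeq_def mono_def)
  have dec: "decseq (\<lambda>n. \<rho> x (C n))"
    unfolding decseq_def using mono C x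
    by (auto intro!: quasi_kappa_metric_antimono[OF \<rho>] simp: mono_def)
  have "bdd_below (range (\<lambda>n. \<rho> x (C n)))"
    using quasi_kappa_metric_nonneg[OF \<rho> x C] by (auto intro!: bdd_belowI)
  then show ?thesis
    unfolding eq using dec by (intro LIMSEQ_decseq_INF)
qed

text \<open>The sequence chosen in the proof need not be cofinal in \<open>r\<close>, so the closure
  \<open>E\<close> of its union may be smaller than \<open>D\<close>. This does no harm: \<rho>(.,
  \<open>E\<close>) is still the continuous limit along the sequence, and the contradiction comes
  only from drops between consecutive terms.\<close>

lemma quasi_kappa_metric_uniform_INF:
  fixes r :: "'i rel" and C :: "'i \<Rightarrow> 'a set"
  assumes X: "pseudocompact_space X" and \<rho>: "quasi_kappa_metric_on X \<rho>"
    and r: "Well_order r" "Field r \<noteq> {}"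
    and C: "\<And>\<alpha>. \<alpha> \<in> Field r \<Longrightarrow> regularly_closedin X (C \<alpha>)"
    and mono: "\<And>\<alpha> \<beta>. (\<alpha>, \<beta>) \<in> r \<Longrightarrow> C \<alpha> \<subseteq> C \<beta>"
    and \<epsilon>: "0 < \<epsilon>"
  obtains (uniform) \<alpha> where "\<alpha> \<in> Field r"
    "\<And>x. x \<in> topspace X \<Longrightarrow> \<rho> x (C \<alpha>) < \<rho> x (X closure_of (\<Union>\<alpha>\<in>Field r. C \<alpha>)) + \<epsilon>"
proof (rule ccontr)
  define D where "D = X closure_of (\<Union>\<alpha>\<in>Field r. C \<alpha>)"
  assume "\<not> thesis"
  then have ex: "\<exists>x. x \<in> topspace X \<and> \<rho> x D + \<epsilon> \<le> \<rho> x (C \<alpha>)" if \<alpha>: "\<alpha> \<in> Field r" for \<alpha>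
    using \<open>\<not> thesis\<close> uniform \<alpha> unfolding D_def by (meson not_le)
  have step: "\<exists>\<beta>. \<beta> \<in> Field r \<and> C \<alpha> \<subseteq> C \<beta> \<and>
      (\<exists>x\<in>topspace X. \<rho> x (C \<beta>) + \<epsilon> / 2 < \<rho> x (C \<alpha>))"
    if \<alpha>: "\<alpha> \<in> Field r" for \<alpha>
  proof -
    obtain x where x: "x \<in> topspace X" "\<rho> x D + \<epsilon> \<le> \<rho> x (C \<alpha>)"
      using ex[OF \<alpha>] by blast
    have "\<rho> x D = (INF \<alpha>\<in>Field r. \<rho> x (C \<alpha>))"
      unfolding D_def by (rule quasi_kappa_metric_on_increasing[OF \<rho> r C mono x(1)])
    then have "(INF \<alpha>\<in>Field r. \<rho> x (C \<alpha>)) < \<rho> x D + \<epsilon> / 2"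
      using \<epsilon> by simp
    \<comment> \<open>\<rho> x \<open>D\<close> is the infimum at this particular x, so some index
      comes within \<epsilon>/2 of it there. As \<open>C \<alpha>\<close> is at least \<epsilon>
      above it, the drop exceeds \<epsilon>/2.\<close>
    then obtain \<beta> where \<beta>: "\<beta> \<in> Field r" "\<rho> x (C \<beta>) < \<rho> x D + \<epsilon> / 2"
      using cInf_lessD[of "(\<lambda>\<alpha>. \<rho> x (C \<alpha>)) ` Field r"] r(2) by blast
    have lt: "\<rho> x (C \<beta>) + \<epsilon> / 2 < \<rho> x (C \<alpha>)"
      using x(2) \<beta>(2) by simp
    \<comment> \<open>By (K2) this inclusion would make \<rho> x larger or equal at
      \<open>C \<beta>\<close>, against the drop; totality of \<open>r\<close> then forces the
      opposite inclusion.\<close>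
    have "\<not> C \<beta> \<subseteq> C \<alpha>"
      using quasi_kappa_metric_antimono[OF \<rho> C[OF \<beta>(1)] C[OF \<alpha>] _ x(1)] lt \<epsilon> by fastforce
    moreover have "\<alpha> = \<beta> \<or> (\<alpha>, \<beta>) \<in> r \<or> (\<beta>, \<alpha>) \<in> r"
      using r(1) \<alpha> \<beta>(1) by (auto simp: order_on_defs total_on_def)
    ultimately have "C \<alpha> \<subseteq> C \<beta>" using mono by blast
    then show ?thesis using \<beta>(1) lt x(1) by blast
  qed
  then obtain s where s: "\<And>\<alpha>. \<alpha> \<in> Field r \<Longrightarrow> s \<alpha> \<in> Field r \<and> C \<alpha> \<subseteq> C (s \<alpha>) \<and>
      (\<exists>x\<in>topspace X. \<rho> x (C (s \<alpha>)) + \<epsilon> / 2 < \<rho> x (C \<alpha>))"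
    by metis
  obtain \<alpha>0 where \<alpha>0: "\<alpha>0 \<in> Field r" using r(2) by blast
  define a where "a n = (s ^^ n) \<alpha>0" for n
  have a: "a n \<in> Field r" for n
    by (induction n) (use \<alpha>0 s in \<open>auto simp: a_def\<close>)
  have rc: "regularly_closedin X (C (a n))" for n
    using C a by blast
  have aS: "a (Suc n) = s (a n)" for n
    by (simp add: a_def)
  have inc: "mono (\<lambda>n. C (a n))"
    unfolding mono_iff_le_Suc using s a aS by auto
  define E where "E = X closure_of (\<Union>n. C (a n))"
  have rE: "regularly_closedin X E"
    unfolding E_def by (rule regularly_closedin_closure_of_Union) (rule rc)
  have CE: "C (a n) \<subseteq> E" for n
  proof -
    have "C (a n) \<subseteq> topspace X" for n
      using rc[of n] unfolding regularly_closedin_def by (auto dest: in_closure_of[THEN iffD1])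
    then show ?thesis
      unfolding E_def by (meson UN_least UN_upper UNIV_I closure_of_subset order_trans)
  qed
  obtain n where n: "\<And>x. x \<in> topspace X \<Longrightarrow> \<rho> x (C (a n)) - \<rho> x E < \<epsilon> / 2"
  proof (rule pseudocompact_Dini[OF X, of "\<lambda>n x. \<rho> x (C (a n)) - \<rho> x E" "\<epsilon> / 2"])
    show "continuous_map X euclideanreal (\<lambda>x. \<rho> x (C (a n)) - \<rho> x E)" for n
      by (intro continuous_map_diff quasi_kappa_metric_continuous[OF \<rho>] rc rE)
    show "decseq (\<lambda>n. \<rho> x (C (a n)) - \<rho> x E)" if "x \<in> topspace X" for x
      using quasi_kappa_metric_antimono[OF \<rho> rc rc _ that] monoD[OF inc]
      by (auto simp: decseq_def)
    show "(\<lambda>n. \<rho> x (C (a n)) - \<rho> x E) \<longlonglongrightarrow> 0" if "x \<in> topspace X" for x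
      using quasi_kappa_metric_LIMSEQ[OF \<rho> rc inc that]
      unfolding E_def[symmetric] by (simp add: LIM_zero)
  qed (use \<epsilon> in auto)
  \<comment> \<open>The next step of the sequence drops by more than \<epsilon>/2 at some x, and
    \<rho> x \<open>E\<close> is no larger than the value after the drop; Dini allows a gap of less
    than \<epsilon>/2 in total.\<close>
  obtain x where x: "x \<in> topspace X" "\<rho> x (C (a (Suc n))) + \<epsilon> / 2 < \<rho> x (C (a n))"
    using s[OF a[of n]] aS by metis
  have "\<rho> x E \<le> \<rho> x (C (a (Suc n)))"
    by (rule quasi_kappa_metric_antimono[OF \<rho> rc rE CE x(1)])
  then show False using n[OF x(1)] x(2) by simp
qed

section \<open>Traces of sets under a dense embedding\<close>

locale dense_embedding =
  fixes X :: "'a topology" and Y :: "'b topology" and e :: "'a \<Rightarrow> 'b"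
  assumes embedding: "embedding_map X Y e"
    and dense: "Y closure_of (e ` topspace X) = topspace Y"
begin

definition trace :: "'b set \<Rightarrow> 'a set" where
  "trace A = {x \<in> topspace X. e x \<in> A}"

lemma continuous: "continuous_map X Y e"
  using embedding homeomorphic_imp_continuous_map continuous_map_in_subtopology
  unfolding embedding_map_def by blast

lemma in_topspace: "x \<in> topspace X \<Longrightarrow> e x \<in> topspace Y"
  using continuous continuous_map_image_subset_topspace by blast

lemma openin_trace: "openin Y U \<Longrightarrow> openin X (trace U)"
  unfolding trace_def by (rule openin_continuous_map_preimage[OF continuous])

lemma trace_mono: "A \<subseteq> B \<Longrightarrow> trace A \<subseteq> trace B"
  by (auto simp: trace_def)

lemma trace_UN: "trace (\<Union>i\<in>I. A i) = (\<Union>i\<in>I. trace (A i))"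
  by (auto simp: trace_def)

lemma trace_nonempty:
  assumes "openin Y U" "p \<in> U"
  obtains x where "x \<in> trace U"
proof -
  have "p \<in> Y closure_of (e ` topspace X)"
    using assms openin_subset dense by blast
  then show ?thesis
    using assms that unfolding in_closure_of trace_def by blast
qed

text \<open>An embedding makes the image of \<open>N\<close> relatively open in the image of X, and
  injectivity ensures that pulling an open extension back adds no further points.\<close>

lemma openin_extend:
  assumes "openin X N"
  obtains N' where "openin Y N'" "trace N' = N"
proof -
  have hom: "homeomorphic_map X (subtopology Y (e ` topspace X)) e"
    using embedding by (simp add: embedding_map_def)
  have sub: "N \<subseteq> topspace X" using assms openin_subset by blast
  have "openin (subtopology Y (e ` topspace X)) (e ` N)"
    using homeomorphic_map_openness[OF hom sub] assms by blast
  then obtain N' where N': "openin Y N'" "e ` N = N' \<inter> e ` topspace X"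
    unfolding openin_subtopology by blast
  have "inj_on e (topspace X)"
    using hom by (simp add: homeomorphic_eq_everything_map)
  then have "trace N' = N"
    using N'(2) sub unfolding trace_def inj_on_def by blast
  then show ?thesis using that N'(1) by blast
qed

lemma closure_of_trace_subset: "X closure_of (trace A) \<subseteq> trace (Y closure_of A)"
proof -
  have "e ` (X closure_of (trace A)) \<subseteq> Y closure_of (e ` trace A)"
    using continuous unfolding continuous_map_eq_image_closure_subset image_subset_iff_funcset
    by (rule spec)
  also have "\<dots> \<subseteq> Y closure_of A"
    by (rule closure_of_mono) (auto simp: trace_def)
  finally show ?thesis
    using closure_of_subset_topspace[of X "trace A"] unfolding trace_def by blast
qed

text \<open>One inclusion is continuity. For the other, a neighbourhood of x extends to an open set
  of Y meeting \<open>U\<close>; this intersection is open because \<open>U\<close> is, so it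
  contains a point of the dense image.\<close>

lemma trace_closure_of:
  assumes U: "openin Y U"
  shows "trace (Y closure_of U) = X closure_of (trace U)"
proof
  show "trace (Y closure_of U) \<subseteq> X closure_of (trace U)"
  proof
    fix x
    assume x: "x \<in> trace (Y closure_of U)"
    have "\<exists>z. z \<in> trace U \<and> z \<in> N" if N: "openin X N" "x \<in> N" for N
    proof -
      obtain N' where N': "openin Y N'" "trace N' = N"
        using openin_extend[OF N(1)] .
      then obtain q where "q \<in> N' \<inter> U"
        using x N(2) unfolding trace_def in_closure_of by blast
      then obtain z where "z \<in> trace (N' \<inter> U)"
        using trace_nonempty openin_Int[OF N'(1) U] by metis
      then show ?thesis using N'(2) by (auto simp: trace_def)
    qed
    then show "x \<in> X closure_of (trace U)"
      using x by (auto simp: in_closure_of trace_def)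
  qed
qed (rule closure_of_trace_subset)

lemma regularly_closedin_trace:
  "regularly_closedin Y F \<Longrightarrow> regularly_closedin X (trace F)"
  unfolding regularly_closedin_def using trace_closure_of openin_trace by blast

text \<open>Taking traces commutes with closure for open sets, so the union is first replaced by an
  open subset of it with the same closure.\<close>

lemma trace_closure_of_Union:
  assumes "\<And>i. i \<in> I \<Longrightarrow> regularly_closedin Y (F i)"
  shows "trace (Y closure_of (\<Union>i\<in>I. F i)) = X closure_of (\<Union>i\<in>I. trace (F i))"
proof
  obtain U where U: "openin Y U" "U \<subseteq> (\<Union>i\<in>I. F i)"
      "Y closure_of (\<Union>i\<in>I. F i) = Y closure_of U"
    using regularly_closedin_closure_Union[of I Y F] assms by metis
  show "trace (Y closure_of (\<Union>i\<in>I. F i)) \<subseteq> X closure_of (\<Union>i\<in>I. trace (F i))"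
    unfolding U(3) trace_closure_of[OF U(1)] trace_UN[symmetric]
    by (intro closure_of_mono trace_mono U(2))
qed (use closure_of_trace_subset[of "\<Union>i\<in>I. F i"] in \<open>simp add: trace_UN\<close>)

text \<open>A failure at \<open>p\<close> would persist on an open set around \<open>p\<close>,
  which meets \<open>U\<close> in a nonempty open set and hence in the dense image. Allowing a
  general \<open>U\<close> lets inequalities be proved on a single regularly closed set.\<close>

lemma le_on_dense:
  fixes g h :: "'b \<Rightarrow> real"
  assumes g: "continuous_map Y euclideanreal g" and h: "continuous_map Y euclideanreal h"
    and U: "openin Y U" and le: "\<And>x. x \<in> trace U \<Longrightarrow> g (e x) \<le> h (e x)"
    and p: "p \<in> Y closure_of U"
  shows "g p \<le> h p"
proof (rule ccontr)
  assume "\<not> g p \<le> h p"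
  let ?W = "{q \<in> topspace Y. g q - h q \<in> {0<..}}"
  have "openin Y ?W"
    by (rule openin_continuous_map_preimage[OF continuous_map_diff[OF g h]]) auto
  moreover have "p \<in> ?W"
    using p \<open>\<not> g p \<le> h p\<close> by (auto simp: in_closure_of)
  ultimately obtain q where "q \<in> ?W \<inter> U"
    using p unfolding in_closure_of by (metis IntI)
  then obtain x where "x \<in> trace (?W \<inter> U)"
    using trace_nonempty openin_Int[OF \<open>openin Y ?W\<close> U] by metis
  then show False
    using le[of x] by (auto simp: trace_def)
qed

lemma le_everywhere:
  fixes g h :: "'b \<Rightarrow> real"
  assumes "continuous_map Y euclideanreal g" "continuous_map Y euclideanreal h"
    and "\<And>x. x \<in> topspace X \<Longrightarrow> g (e x) \<le> h (e x)" and "p \<in> topspace Y"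
  shows "g p \<le> h p"
  using le_on_dense[of g h "topspace Y" p] assms by (simp add: trace_def)

section \<open>Transfer of the axioms to continuous extensions\<close>

context
  fixes \<rho> :: "'a \<Rightarrow> 'a set \<Rightarrow> real" and \<sigma> :: "'b \<Rightarrow> 'b set \<Rightarrow> real"
  assumes \<sigma>_continuous: "\<And>F. regularly_closedin Y F \<Longrightarrow> continuous_map Y euclideanreal (\<lambda>p. \<sigma> p F)"
    and \<sigma>_extends: "\<And>F x. regularly_closedin Y F \<Longrightarrow> x \<in> topspace X \<Longrightarrow> \<sigma> (e x) F = \<rho> x (trace F)"
begin

text \<open>The positivity set of \<sigma>(., \<open>F\<close>) serves as \<open>V\<close>. It
  misses \<open>F\<close> because \<sigma>(., \<open>F\<close>) vanishes on the trace of a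
  generating open set, hence on its closure; it is dense off \<open>F\<close> because (K1)* on X
  supplies positive values in every nonempty open trace off \<open>F\<close>.\<close>

lemma extension_positive_set:
  assumes \<rho>: "quasi_kappa_metric_on X \<rho>" and F: "regularly_closedin Y F"
  shows "\<exists>V. openin (subtopology Y (topspace Y - F)) V \<and>
             subtopology Y (topspace Y - F) closure_of V = topspace Y - F \<and>
             (\<forall>p\<in>topspace Y. \<sigma> p F > 0 \<longleftrightarrow> p \<in> V)"
proof -
  note rc = regularly_closedin_trace[OF F]
  obtain U where U: "openin Y U" "F = Y closure_of U"
    using F unfolding regularly_closedin_def by blast
  define V where "V = {p \<in> topspace Y. \<sigma> p F \<in> {0<..}}"
  have V: "openin Y V"
    unfolding V_def by (rule openin_continuous_map_preimage[OF \<sigma>_continuous[OF F]]) auto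
  have "\<sigma> p F \<le> 0" if "p \<in> F" for p
  proof (rule le_on_dense[OF \<sigma>_continuous[OF F] _ U(1)])
    fix x
    assume "x \<in> trace U"
    then have "x \<in> topspace X" "x \<in> trace F"
      using closure_of_subset[OF openin_subset[OF U(1)]] U(2) by (auto simp: trace_def)
    then show "\<sigma> (e x) F \<le> 0"
      using quasi_kappa_metric_eq_0[OF \<rho> rc] \<sigma>_extends[OF F] by simp
  qed (use that U(2) in auto)
  then have VF: "V \<subseteq> topspace Y - F"
    by (fastforce simp: V_def)
  have "p \<in> Y closure_of V" if p: "p \<in> topspace Y - F" for p
    unfolding in_closure_of
  proof (intro conjI allI impI)
    fix N
    assume N: "p \<in> N \<and> openin Y N"
    have "openin Y (N - F)"
      using N U(2) by (intro openin_diff) auto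
    then obtain z where z: "z \<in> trace (N - F)" and op: "openin X (trace (N - F))"
      using trace_nonempty[of "N - F" p] openin_trace[of "N - F"] N p by auto
    obtain V0 where V0: "subtopology X (topspace X - trace F) closure_of V0 = topspace X - trace F"
      "\<And>x. x \<in> topspace X \<Longrightarrow> \<rho> x (trace F) > 0 \<longleftrightarrow> x \<in> V0"
      using quasi_kappa_metric_positive_set[OF \<rho> rc] by metis
    \<comment> \<open>The point z lies off \<open>trace F\<close>, so it is in the closure of
      \<open>V0\<close>, and its neighbourhood \<open>trace (N - F)\<close> contains a point of
      positive \<rho>.\<close>
    have "z \<in> subtopology X (topspace X - trace F) closure_of V0"
      using z V0(1) by (auto simp: trace_def)
    then have "z \<in> X closure_of V0"
      by (metis IntD2 closure_of_mono closure_of_subtopology inf_le2 subsetD)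
    then obtain w where "w \<in> V0" "w \<in> trace (N - F)"
      using z op unfolding in_closure_of by blast
    then have "e w \<in> V" "e w \<in> N"
      using V0(2)[of w] \<sigma>_extends[OF F, of w] in_topspace by (auto simp: V_def trace_def)
    then show "\<exists>y. y \<in> V \<and> y \<in> N" by blast
  qed (use p in auto)
  then have "subtopology Y (topspace Y - F) closure_of V = topspace Y - F"
    using VF by (auto simp: closure_of_subtopology Int_absorb1)
  moreover have "openin (subtopology Y (topspace Y - F)) V"
    using V VF by (metis inf.absorb1 openin_subtopology)
  ultimately show ?thesis
    by (intro exI[of _ V]) (auto simp: V_def)
qed

text \<open>Inequalities between continuous functions pass from the dense image to Y, which settles
  nonnegativity and (K2). An infimum is not such an inequality, so (K4) relies on the uniform
  estimate on X.\<close>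

lemma quasi_kappa_metric_on_extension:
  assumes X: "pseudocompact_space X" and \<rho>: "quasi_kappa_metric_on X \<rho>"
  shows "quasi_kappa_metric_on Y \<sigma>"
proof -
  note rc = regularly_closedin_trace
  have nonneg: "0 \<le> \<sigma> p F" if "p \<in> topspace Y" "regularly_closedin Y F" for p F
    using that by (intro le_everywhere[of "\<lambda>_. 0" "\<lambda>p. \<sigma> p F" p])
      (auto simp: \<sigma>_continuous \<sigma>_extends rc quasi_kappa_metric_nonneg[OF \<rho>])
  have anti: "\<sigma> p F' \<le> \<sigma> p F"
    if "regularly_closedin Y F" "regularly_closedin Y F'" "F \<subseteq> F'" "p \<in> topspace Y" for p F F'
    using that by (intro le_everywhere[of "\<lambda>p. \<sigma> p F'" "\<lambda>p. \<sigma> p F" p])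
      (auto simp: \<sigma>_continuous \<sigma>_extends rc trace_mono quasi_kappa_metric_antimono[OF \<rho>])
  have K4: "\<sigma> p (Y closure_of (\<Union>\<alpha>\<in>Field r. F \<alpha>)) = (INF \<alpha>\<in>Field r. \<sigma> p (F \<alpha>))"
    if r: "Well_order r" "Field r \<noteq> {}"
      and F: "\<And>\<alpha>. \<alpha> \<in> Field r \<Longrightarrow> regularly_closedin Y (F \<alpha>)"
      and mono: "\<And>\<alpha> \<beta>. (\<alpha>, \<beta>) \<in> r \<Longrightarrow> F \<alpha> \<subseteq> F \<beta>"
      and p: "p \<in> topspace Y"
    for r :: "'b set rel" and F p
  proof (rule antisym)
    let ?D = "Y closure_of (\<Union>\<alpha>\<in>Field r. F \<alpha>)"
    have D: "regularly_closedin Y ?D"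
      using F by (rule regularly_closedin_closure_of_Union)
    have sub: "F \<alpha> \<subseteq> ?D" if "\<alpha> \<in> Field r" for \<alpha>
    proof -
      have "F \<beta> \<subseteq> topspace Y" if "\<beta> \<in> Field r" for \<beta>
        using F[OF that] closure_of_subset_topspace unfolding regularly_closedin_def by metis
      then show ?thesis
        using that closure_of_subset[of "\<Union>\<alpha>\<in>Field r. F \<alpha>" Y] by blast
    qed
    show "\<sigma> p ?D \<le> (INF \<alpha>\<in>Field r. \<sigma> p (F \<alpha>))"
      using r(2) by (intro cINF_greatest anti F D sub p)
    show "(INF \<alpha>\<in>Field r. \<sigma> p (F \<alpha>)) \<le> \<sigma> p ?D"
    proof (rule field_le_epsilon)
      fix \<epsilon> :: real
      assume \<epsilon>: "0 < \<epsilon>"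
      \<comment> \<open>One index works for all x at once, so the estimate becomes an inequality
        between two continuous functions and extends to every \<open>p\<close>.\<close>
      obtain \<alpha> where \<alpha>: "\<alpha> \<in> Field r" "\<And>x. x \<in> topspace X \<Longrightarrow>
          \<rho> x (trace (F \<alpha>)) < \<rho> x (X closure_of (\<Union>\<alpha>\<in>Field r. trace (F \<alpha>))) + \<epsilon>"
        using quasi_kappa_metric_uniform_INF[OF X \<rho> r, of "\<lambda>\<alpha>. trace (F \<alpha>)" \<epsilon>]
          rc[OF F] trace_mono[OF mono] \<epsilon> by blast
      have "\<sigma> p (F \<alpha>) \<le> \<sigma> p ?D + \<epsilon>"
      proof (rule le_everywhere[of "\<lambda>p. \<sigma> p (F \<alpha>)" "\<lambda>p. \<sigma> p ?D + \<epsilon>"])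
        show "continuous_map Y euclideanreal (\<lambda>p. \<sigma> p ?D + \<epsilon>)"
          by (intro continuous_map_add \<sigma>_continuous D) auto
        show "\<sigma> (e x) (F \<alpha>) \<le> \<sigma> (e x) ?D + \<epsilon>" if "x \<in> topspace X" for x
          using \<alpha>(2)[OF that] trace_closure_of_Union[of "Field r" F] F \<alpha>(1) that
          by (simp add: \<sigma>_extends D)
      qed (use \<alpha>(1) F p in \<open>auto intro: \<sigma>_continuous\<close>)
      moreover have "(INF \<alpha>\<in>Field r. \<sigma> p (F \<alpha>)) \<le> \<sigma> p (F \<alpha>)"
        using nonneg[OF p F] \<alpha>(1) by (intro cINF_lower) (auto intro!: bdd_belowI2)
      ultimately show "(INF \<alpha>\<in>Field r. \<sigma> p (F \<alpha>)) \<le> \<sigma> p ?D + \<epsilon>"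
        by linarith
    qed
  qed
  show ?thesis
    unfolding quasi_kappa_metric_on_def
  proof (intro conjI allI impI ballI; (elim conjE)?)
    fix r :: "'b set rel" and F p
    assume "Well_order r" "Field r \<noteq> {}" "\<forall>\<alpha>\<in>Field r. regularly_closedin Y (F \<alpha>)"
      "\<forall>\<alpha> \<beta>. (\<alpha>, \<beta>) \<in> r \<longrightarrow> F \<alpha> \<subseteq> F \<beta>" "p \<in> topspace Y"
    then show "\<sigma> p (Y closure_of (\<Union>\<alpha>\<in>Field r. F \<alpha>)) = (INF \<alpha>\<in>Field r. \<sigma> p (F \<alpha>))"
      by (intro K4) auto
  qed (rule nonneg anti \<sigma>_continuous extension_positive_set[OF \<rho>]; assumption)+
qed

text \<open>An infinite supremum makes (K5) trivial. A finite one is a constant \<open>s\<close>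
  independent of the point, so (K5) becomes a continuous inequality that need only be checked on
  X.\<close>

lemma regular_quasi_kappa_metric_on_extension:
  assumes X: "pseudocompact_space X" and \<rho>: "regular_quasi_kappa_metric_on X \<rho>"
  shows "regular_quasi_kappa_metric_on Y \<sigma>"
proof -
  have \<rho>': "quasi_kappa_metric_on X \<rho>"
    and K5: "\<And>x C C'. x \<in> topspace X \<Longrightarrow> regularly_closedin X C \<Longrightarrow> regularly_closedin X C' \<Longrightarrow>
        ennreal (\<rho> x C) \<le> ennreal (\<rho> x C') + (SUP y\<in>C'. ennreal (\<rho> y C))"
    using \<rho> unfolding regular_quasi_kappa_metric_on_def by auto
  note rc = regularly_closedin_trace
  have qY: "quasi_kappa_metric_on Y \<sigma>"
    by (rule quasi_kappa_metric_on_extension[OF X \<rho>'])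
  have "ennreal (\<sigma> p F) \<le> ennreal (\<sigma> p F') + (SUP q\<in>F'. ennreal (\<sigma> q F))"
    if p: "p \<in> topspace Y" and F: "regularly_closedin Y F" and F': "regularly_closedin Y F'"
    for p F F'
  proof (cases "SUP q\<in>F'. ennreal (\<sigma> q F)")
    case (real s)
    have "\<sigma> p F \<le> \<sigma> p F' + s"
    proof (rule le_everywhere[of "\<lambda>p. \<sigma> p F" "\<lambda>p. \<sigma> p F' + s"])
      show "continuous_map Y euclideanreal (\<lambda>p. \<sigma> p F' + s)"
        by (intro continuous_map_add \<sigma>_continuous F') auto
      show "\<sigma> (e x) F \<le> \<sigma> (e x) F' + s" if x: "x \<in> topspace X" for x
      proof -
        \<comment> \<open>Points of \<open>trace F'\<close> map into \<open>F'\<close> with equal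
          values, while \<open>F'\<close> may have further points; so the bound from X is at most
          \<open>s\<close>.\<close>
        have "(SUP y\<in>trace F'. ennreal (\<rho> y (trace F))) \<le> (SUP q\<in>F'. ennreal (\<sigma> q F))"
        proof (rule SUP_mono)
          fix y
          assume "y \<in> trace F'"
          then show "\<exists>q\<in>F'. ennreal (\<rho> y (trace F)) \<le> ennreal (\<sigma> q F)"
            using \<sigma>_extends[OF F, of y] by (intro bexI[of _ "e y"]) (auto simp: trace_def)
        qed
        then have "ennreal (\<rho> x (trace F)) \<le> ennreal (\<rho> x (trace F')) + ennreal s"
          using K5[OF x rc[OF F] rc[OF F']] unfolding real(2)
          by (meson add_left_mono order_trans)
        \<comment> \<open>\<open>ennreal\<close> sends negative reals to 0, so nonnegativity is what
          permits the return to a real inequality.\<close>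
        then show ?thesis
          using quasi_kappa_metric_nonneg[OF \<rho>' x rc] real(1) F F' x
          by (simp add: \<sigma>_extends ennreal_plus[symmetric] del: ennreal_plus)
      qed
    qed (use F p in \<open>auto intro: \<sigma>_continuous\<close>)
    then show ?thesis
      using quasi_kappa_metric_nonneg[OF qY p] F F' real
      by (simp add: ennreal_plus[symmetric] del: ennreal_plus)
  next
    case top
    show ?thesis
      unfolding top by simp
  qed
  then show ?thesis
    using qY unfolding regular_quasi_kappa_metric_on_def by blast
qed

end

end

section \<open>Application to the Cech-Stone compactification\<close>

lemma Cech_Stone_extension_pseudocompact:
  fixes f :: "'a \<Rightarrow> real"
  assumes X: "pseudocompact_space X" and f: "continuous_map X euclideanreal f"
  shows "\<exists>g. continuous_map (Cech_Stone X) euclideanreal g \<and>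
             (\<forall>x\<in>topspace X. g (Cech_Stone_map X x) = f x)"
proof -
  obtain B where B: "0 < B" "\<And>x. x \<in> topspace X \<Longrightarrow> \<bar>f x\<bar> \<le> B"
  proof -
    have "bounded (f ` topspace X)"
      using X f by (simp add: pseudocompact_space_def)
    then show ?thesis
      using that unfolding bounded_pos by auto
  qed
  \<comment> \<open>Pseudocompactness bounds \<open>f\<close> by a positive \<open>B\<close>; this
    affine change carries [-\<open>B\<close>, \<open>B\<close>] to the unit interval, where
    extensions exist, and is inverted after extending.\<close>
  have "continuous_map X euclideanreal (\<lambda>x. (f x + B) / (2 * B))"
    using B(1) by (intro continuous_map_real_divide continuous_map_add f) auto
  moreover have "(f x + B) / (2 * B) \<in> {0..1}" if "x \<in> topspace X" for x
    using B(1) B(2)[OF that] by (auto simp: field_simps abs_le_iff)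
  ultimately have "continuous_map X (top_of_set {0..1}) (\<lambda>x. (f x + B) / (2 * B))"
    by (auto simp: continuous_map_in_subtopology)
  then obtain g where g: "continuous_map (Cech_Stone X) (top_of_set {0..1}) g"
    "\<And>x. x \<in> topspace X \<Longrightarrow> g (Cech_Stone_map X x) = (f x + B) / (2 * B)"
    using Cech_Stone_extension[of X "\<lambda>x. (f x + B) / (2 * B)"] by metis
  have "continuous_map (Cech_Stone X) euclideanreal (\<lambda>p. 2 * B * g p - B)"
    using g(1) by (intro continuous_map_diff continuous_map_real_mult)
      (auto simp: continuous_map_in_subtopology)
  then show ?thesis
    using g(2) B(1) by (intro exI[of _ "\<lambda>p. 2 * B * g p - B"]) auto
qed

theorem theorem3p3:
  fixes X :: "'a topology"
  assumes "Tychonoff_space X" and "pseudocompact_space X"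
  shows "(quasi_kappa_metrizable X \<longrightarrow> quasi_kappa_metrizable (Cech_Stone X)) \<and>
         (regularly_quasi_kappa_metrizable X \<longrightarrow>
            regularly_quasi_kappa_metrizable (Cech_Stone X))"
proof -
  interpret dense_embedding X "Cech_Stone X" "Cech_Stone_map X"
    by unfold_locales
       (rule embedding_map_Cech_Stone_map[OF assms(1)], rule dense_Cech_Stone_map)
  have ext: "\<exists>\<sigma>. \<forall>F. regularly_closedin (Cech_Stone X) F \<longrightarrow>
      continuous_map (Cech_Stone X) euclideanreal (\<lambda>p. \<sigma> p F) \<and>
      (\<forall>x\<in>topspace X. \<sigma> (Cech_Stone_map X x) F = \<rho> x (trace F))"
    if \<rho>: "quasi_kappa_metric_on X \<rho>" for \<rho>
  proof -
    \<comment> \<open>The extension is chosen separately for each \<open>F\<close>; for sets that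
      are not regularly closed its value is arbitrary.\<close>
    have "\<exists>g. regularly_closedin (Cech_Stone X) F \<longrightarrow>
        continuous_map (Cech_Stone X) euclideanreal g \<and>
        (\<forall>x\<in>topspace X. g (Cech_Stone_map X x) = \<rho> x (trace F))" for F
      using Cech_Stone_extension_pseudocompact[OF assms(2), of "\<lambda>x. \<rho> x (trace F)"]
        quasi_kappa_metric_continuous[OF \<rho> regularly_closedin_trace] by blast
    then obtain g where "\<And>F. regularly_closedin (Cech_Stone X) F \<longrightarrow>
        continuous_map (Cech_Stone X) euclideanreal (g F) \<and>
        (\<forall>x\<in>topspace X. g F (Cech_Stone_map X x) = \<rho> x (trace F))"
      by metis
    then show ?thesis
      by (intro exI[of _ "\<lambda>p F. g F p"]) auto
  qed
  show ?thesis
  proof (intro conjI impI)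
    assume "quasi_kappa_metrizable X"
    then obtain \<rho> where \<rho>: "quasi_kappa_metric_on X \<rho>"
      unfolding quasi_kappa_metrizable_def by blast
    then show "quasi_kappa_metrizable (Cech_Stone X)"
      using ext[OF \<rho>] quasi_kappa_metric_on_extension[OF _ _ assms(2) \<rho>]
      unfolding quasi_kappa_metrizable_def by metis
  next
    assume "regularly_quasi_kappa_metrizable X"
    then obtain \<rho> where \<rho>: "regular_quasi_kappa_metric_on X \<rho>"
      unfolding regularly_quasi_kappa_metrizable_def by blast
    then have "quasi_kappa_metric_on X \<rho>"
      by (simp add: regular_quasi_kappa_metric_on_def)
    then show "regularly_quasi_kappa_metrizable (Cech_Stone X)"
      using ext regular_quasi_kappa_metric_on_extension[OF _ _ assms(2) \<rho>]
      unfolding regularly_quasi_kappa_metrizable_def by metis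
  qed
qed

end
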